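(* Let $\Delta$ be a reducible simplicial complex on the vertex set $[n]$ with decomposition $(\Delta_1,S,\Delta_2)$, and suppose that $1\in|\Delta_1|\setminus|\Delta_2|$ and $2\in|\Delta_2|\setminus|\Delta_1|$. Let integers $d_3,\ldots,d_n\ge2$ be given. Then there exist constants $(m_1,m_2)=m(\Delta;d_3,\ldots,d_n)$ such that for all integers $d_1,d_2\ge2$, with $d=(d_1,d_2,d_3,\ldots,d_n)$, every element of the universal Markov basis $\mathcal{M}_{\Delta,d}$ has format smaller than $m_1\times m_2\times d_3\times\cdots\times d_n$; that is, for every $\mathbf{v}=(v_{i_1,\ldots,i_n})\in\mathcal{M}_{\Delta,d}$, at most $m_1$ of the slices of $\mathbf{v}$ obtained by fixing the first index $i_1\in[d_1]$ are nonzero, and at most $m_2$ of the slices obtained by fixing the second index $i_2\in[d_2]$ are nonzero.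
   Context: $[k]=\{1,\ldots,k\}$, $\mathbb{N}=\{0,1,2,\ldots\}$. For a simplicial complex $\Delta$, $|\Delta|=\bigcup_{F\in\Delta}F$ is its underlying vertex set. $\Delta$ is reducible with decomposition $(\Delta_1,S,\Delta_2)$, where $\Delta_1,\Delta_2$ are (induced) subcomplexes, if $S\in\Delta_1$, $S\in\Delta_2$, $|\Delta_1|\cap|\Delta_2|=S$, and $\Delta=\Delta_1\cup\Delta_2$. Let $F_1,\ldots,F_s$ be the facets of $\Delta$ and $d=(d_1,\ldots,d_n)$ with all $d_i\ge2$ integers; put $D=\prod_{i=1}^nd_i$ and $D_k=\prod_{j\in F_k}d_j$. The marginal map is $$\pi_\Delta:\mathbb{N}^D\to\bigoplus_{k=1}^s\mathbb{N}^{D_k},\qquad (u_{i_1,\ldots,i_n}:i_j\in[d_j])\mapsto\bigoplus_{k=1}^s\ \sum_{(i_j:\,j\notin F_k)}u_{i_1,\ldots,i_n},$$ i.e. the $k$-th component is the array indexed by $\prod_{j\in F_k}[d_j]$ obtained by summing $u$ over all indices $i_j$ with $j\notin F_k$. Let $A_\Delta$ be the 0/1 matrix of this linear map. For a matrix $A$ with nonnegative integer entries, $N$ columns and no zero column, a finite set $\mathcal{M}\subset\ker_{\mathbb{Z}}(A)$ (integer kernel vectors) is a Markov basis of $A$ if for any $\mathbf{t},\mathbf{u}\in\mathbb{N}^N$ with $A\mathbf{t}=A\mathbf{u}$ there is a finite sequence $\mathbf{v}_1,\ldots,\mathbf{v}_s$ of elements of $\mathcal{M}$ with $\mathbf{t}+\sum_{i=1}^p\mathbf{v}_i\ge0$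 for all $1\le p\le s$ and $\mathbf{t}+\sum_{i=1}^s\mathbf{v}_i=\mathbf{u}$. It is minimal if no proper subset of it is a Markov basis of $A$. The universal Markov basis $\mathcal{M}(A)$ is the union of all minimal Markov bases of $A$, and $\mathcal{M}_{\Delta,d}:=\mathcal{M}(A_\Delta)$. *)

theory Defs
  imports Main "HOL-Library.FuncSet"
begin

section \<open>Simplicial complexes\<close>

definition abstract_simplicial_complex :: "nat set set \<Rightarrow> bool" where
  "abstract_simplicial_complex \<Delta> \<longleftrightarrow>
     \<Delta> \<noteq> {} \<and> finite \<Delta> \<and> (\<forall>F\<in>\<Delta>. finite F) \<and> (\<forall>F\<in>\<Delta>. \<forall>G. G \<subseteq> F \<longrightarrow> G \<in> \<Delta>)"

definition complex_vertices :: "nat set set \<Rightarrow> nat set" where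
  "complex_vertices \<Delta> = \<Union>\<Delta>"

definition complex_on :: "nat \<Rightarrow> nat set set \<Rightarrow> bool" where
  "complex_on n \<Delta> \<longleftrightarrow> abstract_simplicial_complex \<Delta> \<and> complex_vertices \<Delta> = {1..n}"

definition facets :: "nat set set \<Rightarrow> nat set set" where
  "facets \<Delta> = {F \<in> \<Delta>. \<forall>G\<in>\<Delta>. F \<subseteq> G \<longrightarrow> G = F}"

definition induced_subcomplex :: "nat set set \<Rightarrow> nat set set \<Rightarrow> bool" where
  "induced_subcomplex \<Delta>' \<Delta> \<longleftrightarrow>
     abstract_simplicial_complex \<Delta>' \<and> \<Delta>' = {F \<in> \<Delta>. F \<subseteq> complex_vertices \<Delta>'}"

definition reducible_with ::
  "nat set set \<Rightarrow> nat set set \<Rightarrow> nat set \<Rightarrow> nat set set \<Rightarrow> bool" where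
  "reducible_with \<Delta> \<Delta>\<^sub>1 S \<Delta>\<^sub>2 \<longleftrightarrow>
     induced_subcomplex \<Delta>\<^sub>1 \<Delta> \<and> induced_subcomplex \<Delta>\<^sub>2 \<Delta> \<and>
     S \<in> \<Delta>\<^sub>1 \<and> S \<in> \<Delta>\<^sub>2 \<and>
     complex_vertices \<Delta>\<^sub>1 \<inter> complex_vertices \<Delta>\<^sub>2 = S \<and>
     \<Delta> = \<Delta>\<^sub>1 \<union> \<Delta>\<^sub>2"

section \<open>Markov bases\<close>

text \<open>A matrix is given by a finite set \<open>R\<close> of row indices, a finite set \<open>C\<close> of column
  indices and an entry function \<open>A\<close>; entries outside \<open>R \<times> C\<close> are ignored.  Vectors indexed
  by \<open>C\<close> are functions vanishing off \<open>C\<close>, so that equality of vectors is equality of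
  functions.\<close>

definition vecs :: "'c set \<Rightarrow> ('c \<Rightarrow> 'a::zero) set" where
  "vecs C = {x. \<forall>c. c \<notin> C \<longrightarrow> x c = 0}"

definition mat_apply :: "'c set \<Rightarrow> ('r \<Rightarrow> 'c \<Rightarrow> nat) \<Rightarrow> ('c \<Rightarrow> 'a::semiring_1) \<Rightarrow> 'r \<Rightarrow> 'a" where
  "mat_apply C A x r = (\<Sum>c\<in>C. of_nat (A r c) * x c)"

definition int_kernel :: "'r set \<Rightarrow> 'c set \<Rightarrow> ('r \<Rightarrow> 'c \<Rightarrow> nat) \<Rightarrow> ('c \<Rightarrow> int) set" where
  "int_kernel R C A = {v \<in> vecs C. \<forall>r\<in>R. mat_apply C A v r = 0}"

definition connects :: "'c set \<Rightarrow> ('c \<Rightarrow> int) set \<Rightarrow> ('c \<Rightarrow> nat) \<Rightarrow> ('c \<Rightarrow> nat) \<Rightarrow> bool" where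
  "connects C M t u \<longleftrightarrow>
     (\<exists>vs. set vs \<subseteq> M \<and>
        (\<forall>p\<in>{1..length vs}. \<forall>c\<in>C. int (t c) + (\<Sum>i<p. (vs ! i) c) \<ge> 0) \<and>
        (\<forall>c\<in>C. int (t c) + (\<Sum>i<length vs. (vs ! i) c) = int (u c)))"

definition markov_basis ::
  "'r set \<Rightarrow> 'c set \<Rightarrow> ('r \<Rightarrow> 'c \<Rightarrow> nat) \<Rightarrow> ('c \<Rightarrow> int) set \<Rightarrow> bool" where
  "markov_basis R C A M \<longleftrightarrow>
     finite M \<and> M \<subseteq> int_kernel R C A \<and>
     (\<forall>t\<in>vecs C. \<forall>u\<in>vecs C.
        (\<forall>r\<in>R. mat_apply C A t r = mat_apply C A u r) \<longrightarrow> connects C M t u)"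

definition minimal_markov_basis ::
  "'r set \<Rightarrow> 'c set \<Rightarrow> ('r \<Rightarrow> 'c \<Rightarrow> nat) \<Rightarrow> ('c \<Rightarrow> int) set \<Rightarrow> bool" where
  "minimal_markov_basis R C A M \<longleftrightarrow>
     markov_basis R C A M \<and> (\<forall>M'. M' \<subset> M \<longrightarrow> \<not> markov_basis R C A M')"

definition universal_markov_basis ::
  "'r set \<Rightarrow> 'c set \<Rightarrow> ('r \<Rightarrow> 'c \<Rightarrow> nat) \<Rightarrow> ('c \<Rightarrow> int) set" where
  "universal_markov_basis R C A = \<Union>{M. minimal_markov_basis R C A M}"

section \<open>The marginal map of a simplicial complex\<close>

text \<open>The index set \<open>\<Prod>\<^sub>j\<^sub>\<in>\<^sub>J [d\<^sub>j]\<close>.\<close>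

definition cells :: "nat set \<Rightarrow> (nat \<Rightarrow> nat) \<Rightarrow> (nat \<Rightarrow> nat) set" where
  "cells J d = (\<Pi>\<^sub>E j\<in>J. {1..d j})"

text \<open>Coordinates of the codomain are pairs \<open>(F, b)\<close> of a facet \<open>F\<close>, naming the direct
  summand, and an index \<open>b\<close> into the array of that summand.\<close>

definition marginal_index :: "nat set set \<Rightarrow> (nat \<Rightarrow> nat) \<Rightarrow> (nat set \<times> (nat \<Rightarrow> nat)) set" where
  "marginal_index \<Delta> d = (SIGMA F : facets \<Delta>. cells F d)"

definition marginal ::
  "nat \<Rightarrow> (nat \<Rightarrow> nat) \<Rightarrow> ((nat \<Rightarrow> nat) \<Rightarrow> nat) \<Rightarrow> nat set \<times> (nat \<Rightarrow> nat) \<Rightarrow> nat" where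
  "marginal n d u = (\<lambda>(F, b). \<Sum>i | i \<in> cells {1..n} d \<and> restrict i F = b. u i)"

definition marginal_matrix ::
  "nat \<Rightarrow> (nat \<Rightarrow> nat) \<Rightarrow> nat set \<times> (nat \<Rightarrow> nat) \<Rightarrow> (nat \<Rightarrow> nat) \<Rightarrow> nat" where
  "marginal_matrix n d r c = marginal n d (\<lambda>i. if i = c then 1 else 0) r"

lemma finite_cells: "finite J \<Longrightarrow> finite (cells J d)"
  by (simp add: cells_def finite_PiE)

lemma marginal_matrix_eq:
  assumes "c \<in> cells {1..n} d"
  shows "marginal_matrix n d (F, b) c = (if restrict c F = b then 1 else 0)"
proof -
  have "finite {i. i \<in> cells {1..n} d \<and> restrict i F = b}"
    by (rule finite_subset[OF _ finite_cells[of "{1..n}" d]]) auto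
  then show ?thesis
    using assms by (simp add: marginal_matrix_def marginal_def sum.delta)
qed

lemma mat_apply_marginal_matrix:
  "mat_apply (cells {1..n} d) (marginal_matrix n d) u r = marginal n d u r"
proof (cases r)
  case (Pair F b)
  have "(\<Sum>c\<in>cells {1..n} d. marginal_matrix n d (F, b) c * u c)
      = (\<Sum>c\<in>cells {1..n} d. if restrict c F = b then u c else 0)"
    by (rule sum.cong) (auto simp: marginal_matrix_eq)
  also have "\<dots> = (\<Sum>c | c \<in> cells {1..n} d \<and> restrict c F = b. u c)"
    by (simp add: sum.inter_filter finite_cells)
  finally show ?thesis
    by (simp add: Pair mat_apply_def marginal_def)
qed

definition complex_universal_markov_basis ::
  "nat \<Rightarrow> nat set set \<Rightarrow> (nat \<Rightarrow> nat) \<Rightarrow> ((nat \<Rightarrow> nat) \<Rightarrow> int) set" where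
  "complex_universal_markov_basis n \<Delta> d =
     universal_markov_basis (marginal_index \<Delta> d) (cells {1..n} d) (marginal_matrix n d)"

text \<open>The values \<open>a\<close> for which the slice of \<open>v\<close> obtained by fixing the \<open>j\<close>-th index to \<open>a\<close>
  is nonzero.\<close>

definition nonzero_slices ::
  "nat \<Rightarrow> (nat \<Rightarrow> nat) \<Rightarrow> nat \<Rightarrow> ((nat \<Rightarrow> nat) \<Rightarrow> int) \<Rightarrow> nat set" where
  "nonzero_slices n d j v = {a \<in> {1..d j}. \<exists>i\<in>cells {1..n} d. i j = a \<and> v i \<noteq> 0}"

end

theory Submission imports Defs "HOL-Library.Multiset" begin

text \<open>
  Tables are multisets of cells.  A move of a minimal Markov basis never has its negative and
  positive part linked by a chain of tables in the same fibre in which consecutive tables share a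
  cell, since such a chain would make the move redundant.  So it suffices to link any two tables
  in a fibre whose size exceeds a bound independent of \<open>d\<^sub>1\<close> and \<open>d\<^sub>2\<close>: the size of a move
  bounds its number of nonzero slices.

  Restricting to one component \<open>\<Delta>\<^sub>i\<close> leaves a single varying dimension.  There, each slice of a
  pair of tables is a sum of elements from a finite set \<open>G\<close> by Dickson's lemma, and a second
  application of Dickson's lemma, to the multisets over \<open>G\<close> arising in this way, shows that large
  pairs split, as in the finiteness proof for Graver complexities.  If \<open>(x, y) = (p, q) + (p', q')\<close>
  is such a splitting then \<open>q + p'\<close> shares cells with both \<open>x\<close> and \<open>y\<close>.  Chains in the two
  components lift to the whole complex by gluing along \<open>S\<close>.
\<close>

section \<open>Finiteness for tables with one varying dimension\<close>

text \<open>Induction on the alphabet. Once a letter \<open>p\<close> is deleted, only its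
  multiplicity remains to be controlled: one finite set handles the members of \<open>T\<close> with
  many copies of \<open>p\<close>, and each of the finitely many smaller multiplicities gets a
  finite set of its own.\<close>

lemma dickson_multisets:
  fixes T :: "'a multiset set"
  assumes "finite P" and "\<And>t. t \<in> T \<Longrightarrow> set_mset t \<subseteq> P"
  shows "\<exists>T0\<subseteq>T. finite T0 \<and> (\<forall>t\<in>T. \<exists>g\<in>T0. g \<subseteq># t)"
  using assms
proof (induction P arbitrary: T rule: finite_induct)
  case empty
  then have "T \<subseteq> {{#}}" by auto
  then have "finite T" by (rule finite_subset) simp
  then show ?case by blast
next
  case (insert p P)
  define del :: "'a multiset \<Rightarrow> 'a multiset" where "del t = filter_mset (\<lambda>x. x \<noteq> p) t" for t
  have le: "g \<subseteq># t" if "del g \<subseteq># del t" "count g p \<le> count t p" for g t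
  proof (rule mset_subset_eqI)
    fix a show "count g a \<le> count t a"
      using that mset_subset_eq_count[OF that(1), of a] by (cases "a = p") (auto simp: del_def)
  qed
  \<comment> \<open>The induction hypothesis applies to the image of \<open>U\<close> under
    \<open>del\<close>, and the finite set it yields is pulled back to \<open>U\<close>. This is
    used for \<open>T\<close> itself and for the members with a fixed multiplicity of
    \<open>p\<close>.\<close>
  have min: "\<exists>G\<subseteq>U. finite G \<and> (\<forall>t\<in>U. \<exists>g\<in>G. del g \<subseteq># del t)" if "U \<subseteq> T" for U
  proof -
    have "set_mset t \<subseteq> P" if "t \<in> del ` U" for t
    proof -
      from that obtain u where "u \<in> U" "t = del u" by blast
      then show ?thesis using insert.prems[of u] \<open>U \<subseteq> T\<close> by (auto simp: del_def)
    qed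
    then obtain G' where G': "G' \<subseteq> del ` U" "finite G'" "\<forall>t\<in>del ` U. \<exists>g\<in>G'. g \<subseteq># t"
      using insert.IH[of "del ` U"] by blast
    obtain G where G: "G \<subseteq> U" "finite G" "G' = del ` G"
      using finite_subset_image[OF G'(2,1)] by blast
    have "\<forall>t\<in>U. \<exists>g\<in>G. del g \<subseteq># del t"
      using G'(3) unfolding G(3) ball_simps(9) bex_simps(7) .
    with G(1,2) show ?thesis by (intro exI[of _ G] conjI)
  qed
  obtain G where G: "G \<subseteq> T" "finite G" "\<forall>t\<in>T. \<exists>g\<in>G. del g \<subseteq># del t"
    using min[of T] by blast
  \<comment> \<open>If \<open>t\<close> has at least \<open>N\<close> copies of \<open>p\<close>,
    then a \<open>g\<close> in \<open>G\<close> that is below \<open>t\<close> away from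
    \<open>p\<close> is below \<open>t\<close> altogether. The remaining multiplicities
    \<open>k < N\<close> are left to \<open>H k\<close>.\<close>
  obtain N where N: "\<forall>g\<in>G. count g p \<le> N"
    using finite_imageI[OF G(2), of "\<lambda>g. count g p"] by (auto simp: finite_nat_set_iff_bounded_le)
  have "\<exists>H\<subseteq>{t \<in> T. count t p = k}. finite H \<and> (\<forall>t\<in>T. count t p = k \<longrightarrow> (\<exists>g\<in>H. del g \<subseteq># del t))" for k
    using min[of "{t \<in> T. count t p = k}"] by auto
  then obtain H where H: "\<And>k. H k \<subseteq> {t \<in> T. count t p = k}" "\<And>k. finite (H k)"
     "\<And>k. \<forall>t\<in>T. count t p = k \<longrightarrow> (\<exists>g\<in>H k. del g \<subseteq># del t)"
    by metis
  show ?case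
  proof (intro exI conjI ballI)
    show "G \<union> (\<Union>k\<le>N. H k) \<subseteq> T" using G(1) H(1) by blast
    show "finite (G \<union> (\<Union>k\<le>N. H k))" using G(2) H(2) by simp
    fix t assume t: "t \<in> T"
    show "\<exists>g\<in>G \<union> (\<Union>k\<le>N. H k). g \<subseteq># t"
    proof (cases "N \<le> count t p")
      case True
      with G(3) N t le show ?thesis by (meson UnI1 order_trans)
    next
      case False
      obtain g where "g \<in> H (count t p)" "del g \<subseteq># del t" using H(3) t by blast
      moreover from this have "count g p = count t p" using H(1) by blast
      ultimately show ?thesis using le False by (intro bexI[of _ g]) auto
    qed
  qed
qed

section \<open>Images, slices and block decompositions of multisets\<close>

lemma subseteq_image_msetE:
  assumes "w \<subseteq># image_mset f v"
  obtains u where "u \<subseteq># v" "image_mset f u = w"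
proof -
  have "image_mset f v = w + (image_mset f v - w)" using assms by simp
  then obtain u u' where "v = u + u'" "w = image_mset f u"
    using image_mset_eq_plusD by blast
  then show thesis using that[of u] by simp
qed

text \<open>The first component is a tag with two uses: the value of the varying index, and a
  Boolean telling from which table of a pair an element comes (\<open>True\<close> for the
  first).\<close>

definition slice :: "'a \<Rightarrow> ('a \<times> 'e) multiset \<Rightarrow> 'e multiset" where
  "slice a v = image_mset snd (filter_mset (\<lambda>z. fst z = a) v)"

lemma slice_empty [simp]: "slice a {#} = {#}"
  by (simp add: slice_def)

lemma slice_add_mset [simp]:
  "slice a (add_mset z v) = (if fst z = a then add_mset (snd z) (slice a v) else slice a v)"
  by (simp add: slice_def)

lemma slice_union [simp]: "slice a (v + w) = slice a v + slice a w"
  by (simp add: slice_def)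

lemma slice_image_Pair [simp]: "slice a (image_mset (Pair b) g) = (if a = b then g else {#})"
  by (induction g) auto

lemma count_slice [simp]: "count (slice a v) e = count v (a, e)"
  by (induction v) auto

lemma slice_mono: "v \<subseteq># w \<Longrightarrow> slice a v \<subseteq># slice a w"
  by (simp add: subseteq_mset_def)

lemma slice_diff [simp]: "slice a (v - w) = slice a v - slice a w"
  by (rule multiset_eqI) simp

lemma image_Pair_slice_subseteq:
  fixes v :: "('a \<times> 'b) multiset"
  shows "g \<subseteq># slice a v \<Longrightarrow> image_mset (Pair a) g \<subseteq># v"
proof (rule mset_subset_eqI)
  fix z :: "'a \<times> 'b" assume "g \<subseteq># slice a v"
  then have "count g (snd z) \<le> count v (a, snd z)" by (metis count_slice mset_subset_eq_count)
  moreover have "count (image_mset (Pair a) g) z = (if fst z = a then count g (snd z) else 0)"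
    by (metis count_slice slice_image_Pair count_empty prod.collapse)
  ultimately show "count (image_mset (Pair a) g) z \<le> count v z" by (cases z) auto
qed

lemma size_slice_bool: "size v = size (slice True v) + size (slice False v)"
  by (induction v) auto

text \<open>Flattens a multiset of blocks, each block carrying one tag. Since \<open>L\<close> keeps
  the blocks apart, the tags can be forgotten in \<open>image_mset snd L\<close>, a multiset over
  blocks alone, to which Dickson's lemma applies again.\<close>

definition untag :: "('a \<times> 'e multiset) multiset \<Rightarrow> ('a \<times> 'e) multiset" where
  "untag L = sum_mset (image_mset (\<lambda>(a, g). image_mset (Pair a) g) L)"

lemma untag_simps [simp]:
  "untag {#} = {#}" "untag (add_mset z L) = image_mset (Pair (fst z)) (snd z) + untag L"
  "untag (L + L') = untag L + untag L'"
  by (simp_all add: untag_def split_beta)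

lemma image_snd_untag: "image_mset snd (untag L) = sum_mset (image_mset snd L)"
  by (induction L) (auto simp: image_mset.compositionality comp_def)

text \<open>Greedy: split off a block of \<open>G\<close> from some nonempty slice. What remains of
  that slice satisfies \<open>H\<close> by closure under differences, and the total size has
  dropped.\<close>

lemma untag_decomposition:
  assumes G: "\<And>m. m \<noteq> {#} \<Longrightarrow> set_mset m \<subseteq> P \<Longrightarrow> H m \<Longrightarrow> \<exists>g\<in>G. g \<subseteq># m"
    and GH: "\<And>g. g \<in> G \<Longrightarrow> g \<noteq> {#} \<and> H g"
    and sub: "\<And>m m'. H m \<Longrightarrow> H m' \<Longrightarrow> m' \<subseteq># m \<Longrightarrow> H (m - m')"
    and "snd ` set_mset v \<subseteq> P" and "\<And>a. H (slice a v)"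
  shows "\<exists>L. snd ` set_mset L \<subseteq> G \<and> untag L = v"
  using assms(4,5)
proof (induction v rule: measure_induct_rule[where f = size])
  case (less v)
  show ?case
  proof (cases "v = {#}")
    case True then show ?thesis by (intro exI[of _ "{#}"]) simp
  next
    case False
    then obtain a e where "(a, e) \<in># v" by (metis multiset_nonemptyE surj_pair)
    then have "e \<in># slice a v" by (force simp: slice_def)
    then have ne: "slice a v \<noteq> {#}" by auto
    have "set_mset (slice a v) \<subseteq> P" using less.prems(1) by (auto simp: slice_def)
    from G[OF ne this less.prems(2)] obtain g where g: "g \<in> G" "g \<subseteq># slice a v" by blast
    let ?w = "image_mset (Pair a) g"
    have w: "?w \<subseteq># v" using g(2) by (rule image_Pair_slice_subseteq)
    have "?w \<noteq> {#}" using GH g by simp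
    then have "size (v - ?w) < size v"
      using w by (metis subset_mset.add_diff_inverse less_add_same_cancel2 nonempty_has_size size_union)
    moreover have "snd ` set_mset (v - ?w) \<subseteq> P" using less.prems(1) by (auto dest: in_diffD)
    moreover have "H (slice b (v - ?w))" for b
      using sub[OF less.prems(2)] GH g less.prems(2) by auto
    ultimately obtain L where L: "snd ` set_mset L \<subseteq> G" "untag L = v - ?w"
      using less.IH by blast
    show ?thesis
      using L g w by (intro exI[of _ "add_mset (a, g) L"]) auto
  qed
qed

text \<open>Dickson's lemma is applied twice: to the slices satisfying \<open>HA\<close>, which
  gives a finite set \<open>G\<close> of blocks, and to the multisets over \<open>G\<close> whose
  sum satisfies \<open>HB\<close>. Neither application sees the tags, so \<open>K\<close> holds for
  any number of slices.\<close>

lemma bounded_subtable: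
  fixes P :: "'e set" and HA HB :: "'e multiset \<Rightarrow> bool"
  assumes "finite P" and HA0: "HA {#}"
    and add: "\<And>m m'. HA m \<Longrightarrow> HA m' \<Longrightarrow> HA (m + m')"
    and sub: "\<And>m m'. HA m \<Longrightarrow> HA m' \<Longrightarrow> m' \<subseteq># m \<Longrightarrow> HA (m - m')"
  shows "\<exists>K. \<forall>v :: ('a \<times> 'e) multiset. v \<noteq> {#} \<longrightarrow> snd ` set_mset v \<subseteq> P \<longrightarrow>
           (\<forall>a. HA (slice a v)) \<longrightarrow> HB (image_mset snd v) \<longrightarrow>
           (\<exists>w. w \<subseteq># v \<and> w \<noteq> {#} \<and> size w \<le> K \<and> (\<forall>a. HA (slice a w)) \<and> HB (image_mset snd w))"
proof -
  obtain G where G: "G \<subseteq> {m. m \<noteq> {#} \<and> set_mset m \<subseteq> P \<and> HA m}" "finite G"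
    and Gmin: "\<forall>m\<in>{m. m \<noteq> {#} \<and> set_mset m \<subseteq> P \<and> HA m}. \<exists>g\<in>G. g \<subseteq># m"
    using dickson_multisets[OF \<open>finite P\<close>, of "{m. m \<noteq> {#} \<and> set_mset m \<subseteq> P \<and> HA m}"] by blast
  let ?T = "{L. L \<noteq> {#} \<and> set_mset L \<subseteq> G \<and> HB (sum_mset L)}"
  obtain T where T: "T \<subseteq> ?T" "finite T" and Tmin: "\<forall>L\<in>?T. \<exists>L'\<in>T. L' \<subseteq># L"
    using dickson_multisets[OF \<open>finite G\<close>, of ?T] by blast
  obtain K where K: "\<forall>L\<in>T. size (sum_mset L) \<le> K"
    using finite_imageI[OF T(2), of "\<lambda>L. size (sum_mset L)"] by (auto simp: finite_nat_set_iff_bounded_le)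
  show ?thesis
  proof (intro exI[of _ K] allI impI)
    fix v :: "('a \<times> 'e) multiset"
    assume v: "v \<noteq> {#}" "snd ` set_mset v \<subseteq> P" "\<forall>a. HA (slice a v)" "HB (image_mset snd v)"
    have "\<exists>L. snd ` set_mset L \<subseteq> G \<and> untag L = v"
      by (rule untag_decomposition[where H = HA and P = P]) (use G Gmin sub v in auto)
    then obtain L where L: "snd ` set_mset L \<subseteq> G" "untag L = v" by blast
    have "image_mset snd L \<in> ?T"
      using L v by (auto simp: image_snd_untag[symmetric])
    then obtain M where M: "M \<in> T" "M \<subseteq># image_mset snd L" using Tmin by blast
    \<comment> \<open>Lifting \<open>M\<close> to a submultiset of \<open>L\<close> restores a tag
      for each chosen block; flattening \<open>L'\<close> gives the required
      \<open>w\<close>.\<close>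
    then obtain L' where L': "L' \<subseteq># L" "image_mset snd L' = M" by (elim subseteq_image_msetE)
    have M': "image_mset snd (untag L') = sum_mset M" using L' by (simp add: image_snd_untag)
    show "\<exists>w. w \<subseteq># v \<and> w \<noteq> {#} \<and> size w \<le> K \<and> (\<forall>a. HA (slice a w)) \<and> HB (image_mset snd w)"
    proof (intro exI conjI allI)
      obtain L'' where "L = L' + L''" using L'(1) by (metis subset_mset.add_diff_inverse)
      then show "untag L' \<subseteq># v" using L(2) by auto
      have "M \<noteq> {#}" "set_mset M \<subseteq> G" using M T by auto
      then have "sum_mset M \<noteq> {#}" using G by (cases M) auto
      then show "untag L' \<noteq> {#}" using M' by auto
      show "size (untag L') \<le> K" using K M(1) M' by (metis size_image_mset)
      show "HB (image_mset snd (untag L'))" using M(1) M' T by auto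
      fix a
      have "snd ` set_mset L' \<subseteq> G" using L(1) L'(1) by (meson image_mono order_trans set_mset_mono)
      \<comment> \<open>A slice of \<open>untag L'\<close> is a sum of blocks from \<open>G\<close>,
        so closure of \<open>HA\<close> under sums suffices.\<close>
      then show "HA (slice a (untag L'))"
      proof (induction L')
        case empty show ?case using HA0 by simp
      next
        case (add z L')
        then have "HA (snd z)" using G by auto
        with add show ?case using assms(3) by auto
      qed
    qed
  qed
qed

section \<open>Pairs of tables with equal marginals\<close>

text \<open>A marginal array is stored as a multiset of restricted cells, whose multiplicities are
  the array entries by \<open>marginal_count\<close>. The family \<open>Fs\<close> is arbitrary so
  that it can also stand for the faces inside one component or for those avoiding an index.\<close>

definition same_marginals ::
  "nat set set \<Rightarrow> (nat \<Rightarrow> nat) multiset \<Rightarrow> (nat \<Rightarrow> nat) multiset \<Rightarrow> bool" where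
  "same_marginals Fs x y \<longleftrightarrow>
     (\<forall>F\<in>Fs. image_mset (\<lambda>c. restrict c F) x = image_mset (\<lambda>c. restrict c F) y)"

lemma same_marginals_refl [simp]: "same_marginals Fs x x"
  by (simp add: same_marginals_def)

lemma same_marginals_sym: "same_marginals Fs x y \<Longrightarrow> same_marginals Fs y x"
  by (simp add: same_marginals_def)

lemma same_marginals_trans: "same_marginals Fs x y \<Longrightarrow> same_marginals Fs y z \<Longrightarrow> same_marginals Fs x z"
  by (simp add: same_marginals_def)

lemma same_marginals_size: "same_marginals Fs x y \<Longrightarrow> Fs \<noteq> {} \<Longrightarrow> size x = size y"
  by (metis same_marginals_def ex_in_conv size_image_mset)

lemma same_marginals_union:
  "same_marginals Fs x y \<Longrightarrow> same_marginals Fs x' y' \<Longrightarrow> same_marginals Fs (x + x') (y + y')"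
  by (simp add: same_marginals_def)

lemma inter_mset_nonempty:
  assumes "u \<subseteq># x" "u \<subseteq># y" "u \<noteq> {#}"
  shows "x \<inter># y \<noteq> {#}"
proof
  assume "x \<inter># y = {#}"
  moreover have "u \<subseteq># x \<inter># y" using assms by simp
  ultimately show False using assms(3) by simp
qed

lemma slice_slice_image:
  "slice b (slice a (image_mset (\<lambda>(b, c). (k c, (b, f c))) w))
     = image_mset f (filter_mset (\<lambda>c. k c = a) (slice b w))"
  by (induction w) auto

lemma slice_snd_image:
  "slice b (image_mset snd (image_mset (\<lambda>(b, c). (k c, (b, f c))) w)) = image_mset f (slice b w)"
  by (induction w) auto

lemma image_restrict_eq_iff_slices:
  fixes F :: "nat set" and p q :: "(nat \<Rightarrow> nat) multiset"
  assumes "j \<in> F"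
  shows "image_mset (\<lambda>c. restrict c F) p = image_mset (\<lambda>c. restrict c F) q \<longleftrightarrow>
    (\<forall>a. image_mset (\<lambda>c. restrict c (F - {j})) (filter_mset (\<lambda>c. c j = a) p) =
         image_mset (\<lambda>c. restrict c (F - {j})) (filter_mset (\<lambda>c. c j = a) q))"
    (is "?l \<longleftrightarrow> ?r")
proof -
  let ?s = "\<lambda>a. filter_mset (\<lambda>c :: nat \<Rightarrow> nat. c j = a)"
  have s: "?s a (image_mset (\<lambda>c. restrict c F) x) = image_mset (\<lambda>c. restrict c F) (?s a x)"
      for a and x :: "(nat \<Rightarrow> nat) multiset"
    using assms by (induction x) auto
  have "F \<inter> (F - {j}) = F - {j}" by blast
  then have down: "image_mset (\<lambda>c. restrict c (F - {j})) x
      = image_mset (\<lambda>h. restrict h (F - {j})) (image_mset (\<lambda>c. restrict c F) x)"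
      for x :: "(nat \<Rightarrow> nat) multiset"
    by (simp add: image_mset.compositionality comp_def)
  have up: "image_mset (\<lambda>c. restrict c F) (?s a x)
      = image_mset (\<lambda>h. h(j := a)) (image_mset (\<lambda>c. restrict c (F - {j})) (?s a x))"
      for a and x :: "(nat \<Rightarrow> nat) multiset"
  proof -
    have "restrict c F = (restrict c (F - {j}))(j := a)" if "c j = a" for c :: "nat \<Rightarrow> nat"
      using that assms by (auto simp: restrict_def)
    then show ?thesis
      unfolding image_mset.compositionality comp_def by (intro image_mset_cong) simp
  qed
  show ?thesis
  proof
    assume l: ?l
    show ?r
    proof
      fix a
      have "image_mset (\<lambda>c. restrict c F) (?s a p) = image_mset (\<lambda>c. restrict c F) (?s a q)"
        by (simp only: s[symmetric] l)
      then show "image_mset (\<lambda>c. restrict c (F - {j})) (?s a p) = image_mset (\<lambda>c. restrict c (F - {j})) (?s a q)"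
        using down by metis
    qed
  next
    assume r': ?r
    have r: "?s a (image_mset (\<lambda>c. restrict c F) p) = ?s a (image_mset (\<lambda>c. restrict c F) q)" for a
      unfolding s up r'[rule_format] ..
    \<comment> \<open>An entry \<open>h\<close> is counted only in the layer of its own value
      \<open>h j\<close>.\<close>
    show ?l
    proof (rule multiset_eqI)
      fix h
      show "count (image_mset (\<lambda>c. restrict c F) p) h = count (image_mset (\<lambda>c. restrict c F) q) h"
        using arg_cong[OF r, of "\<lambda>x. count x h" "h j"] by simp
    qed
  qed
qed

lemma restrict_cells: "c \<in> cells V d \<Longrightarrow> W \<subseteq> V \<Longrightarrow> restrict c W \<in> cells W d"
  by (auto simp: cells_def PiE_iff)

text \<open>Marginals over sets containing \<open>j\<close> constrain each layer of the pair
  separately (\<open>HA\<close>); the others constrain only the sum of all layers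
  (\<open>HB\<close>). Hence \<open>bounded_subtable\<close> applies, with a bound independent of
  \<open>d' j\<close>.\<close>

lemma bounded_same_marginals:
  assumes "finite V" and FV: "\<And>F. F \<in> Fs \<Longrightarrow> F \<subseteq> V" and "Fs \<noteq> {}"
  shows "\<exists>K. \<forall>d' x y. (\<forall>i\<in>V - {j}. d' i = d i) \<longrightarrow> set_mset x \<subseteq> cells V d' \<longrightarrow> set_mset y \<subseteq> cells V d' \<longrightarrow>
     same_marginals Fs x y \<longrightarrow> x \<noteq> {#} \<longrightarrow>
     (\<exists>p q. p \<subseteq># x \<and> q \<subseteq># y \<and> p \<noteq> {#} \<and> size p \<le> K \<and> same_marginals Fs p q)"
proof -
  let ?V = "V - {j}"
  let ?P = "(UNIV :: bool set) \<times> cells ?V d"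
  define HA :: "(bool \<times> (nat \<Rightarrow> nat)) multiset \<Rightarrow> bool" where
    "HA m \<longleftrightarrow> (\<forall>F\<in>Fs. j \<in> F \<longrightarrow> image_mset (\<lambda>c. restrict c (F - {j})) (slice True m)
                       = image_mset (\<lambda>c. restrict c (F - {j})) (slice False m))" for m
  define HB :: "(bool \<times> (nat \<Rightarrow> nat)) multiset \<Rightarrow> bool" where
    "HB m = same_marginals {F \<in> Fs. j \<notin> F} (slice True m) (slice False m)" for m
  \<comment> \<open>The value at \<open>j\<close> becomes the outer tag. What is left, the Boolean
    and the cell without \<open>j\<close>, ranges over \<open>?P\<close>, which is finite and
    depends only on \<open>d\<close> away from \<open>j\<close>.\<close>
  define \<theta> :: "bool \<times> (nat \<Rightarrow> nat) \<Rightarrow> nat \<times> bool \<times> (nat \<Rightarrow> nat)" where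
    "\<theta> = (\<lambda>(b, c). (c j, (b, restrict c ?V)))"
  have kernel: "same_marginals Fs (slice True w) (slice False w) \<longleftrightarrow>
      (\<forall>a. HA (slice a (image_mset \<theta> w))) \<and> HB (image_mset snd (image_mset \<theta> w))" for w
  proof -
    have 1: "image_mset (\<lambda>c. restrict c (F - {j})) (image_mset (\<lambda>c. restrict c ?V) x)
        = image_mset (\<lambda>c. restrict c (F - {j})) x" if "F \<in> Fs" for F and x :: "(nat \<Rightarrow> nat) multiset"
    proof -
      have "?V \<inter> (F - {j}) = F - {j}" using FV[OF that] by blast
      then show ?thesis by (simp add: image_mset.compositionality comp_def)
    qed
    have 2: "image_mset (\<lambda>c. restrict c F) (image_mset (\<lambda>c. restrict c ?V) x)
        = image_mset (\<lambda>c. restrict c F) x" if "F \<in> Fs" "j \<notin> F" for F and x :: "(nat \<Rightarrow> nat) multiset"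
      using 1[OF that(1)] that(2) by simp
    have "(\<forall>a. HA (slice a (image_mset \<theta> w))) \<longleftrightarrow> (\<forall>F\<in>Fs. j \<in> F \<longrightarrow>
        image_mset (\<lambda>c. restrict c F) (slice True w) = image_mset (\<lambda>c. restrict c F) (slice False w))"
      unfolding HA_def \<theta>_def slice_slice_image by (simp add: 1 image_restrict_eq_iff_slices all_simps) blast
    moreover have "HB (image_mset snd (image_mset \<theta> w)) \<longleftrightarrow> (\<forall>F\<in>Fs. j \<notin> F \<longrightarrow>
        image_mset (\<lambda>c. restrict c F) (slice True w) = image_mset (\<lambda>c. restrict c F) (slice False w))"
      unfolding HB_def \<theta>_def slice_snd_image same_marginals_def by (simp add: 2) blast
    ultimately show ?thesis by (auto simp: same_marginals_def)
  qed
  have "finite ?P" using \<open>finite V\<close> by (simp add: finite_cells)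
  moreover have "HA {#}" by (simp add: HA_def)
  moreover have "HA (m + m')" if "HA m" "HA m'" for m m'
    using that by (simp add: HA_def)
  moreover have "HA (m - m')" if "HA m" "HA m'" "m' \<subseteq># m" for m m'
    using that by (simp add: HA_def image_mset_Diff slice_mono)
  ultimately obtain K where K: "\<forall>v :: (nat \<times> bool \<times> (nat \<Rightarrow> nat)) multiset. v \<noteq> {#} \<longrightarrow> snd ` set_mset v \<subseteq> ?P \<longrightarrow>
           (\<forall>a. HA (slice a v)) \<longrightarrow> HB (image_mset snd v) \<longrightarrow>
           (\<exists>w. w \<subseteq># v \<and> w \<noteq> {#} \<and> size w \<le> K \<and> (\<forall>a. HA (slice a w)) \<and> HB (image_mset snd w))"
    using bounded_subtable[of ?P HA HB] by blast
  show ?thesis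
  proof (intro exI[of _ K] allI impI)
    fix d' x y
    assume d': "\<forall>i\<in>?V. d' i = d i" and C: "set_mset x \<subseteq> cells V d'" "set_mset y \<subseteq> cells V d'"
      and xy: "same_marginals Fs x y" and "x \<noteq> {#}"
    \<comment> \<open>The pair is encoded as one tagged multiset, so that a single submultiset
      yields both \<open>p\<close> and \<open>q\<close>.\<close>
    define v where "v = image_mset (Pair True) x + image_mset (Pair False) y"
    have v: "slice True v = x" "slice False v = y" by (simp_all add: v_def)
    have P: "snd (\<theta> (b, c)) \<in> ?P" if "c \<in> cells V d'" for b c
    proof -
      have "cells ?V d = cells ?V d'" unfolding cells_def using d' by (intro PiE_cong) simp
      then show ?thesis using restrict_cells[OF that, of ?V] by (simp add: \<theta>_def)
    qed
    have "snd ` set_mset (image_mset \<theta> v) \<subseteq> ?P"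
    proof
      fix e assume "e \<in> snd ` set_mset (image_mset \<theta> v)"
      then obtain b c where "e = snd (\<theta> (b, c))" "c \<in># x \<or> c \<in># y" by (auto simp: v_def)
      then show "e \<in> ?P" using P[of c b] C by blast
    qed
    moreover have "image_mset \<theta> v \<noteq> {#}" using \<open>x \<noteq> {#}\<close> by (simp add: v_def)
    ultimately obtain w where w: "w \<subseteq># image_mset \<theta> v" "w \<noteq> {#}" "size w \<le> K"
        "\<forall>a. HA (slice a w)" "HB (image_mset snd w)"
      using K[rule_format, of "image_mset \<theta> v"] kernel[of v] xy v by auto
    then obtain u where u: "u \<subseteq># v" "image_mset \<theta> u = w" by (elim subseteq_image_msetE)
    let ?p = "slice True u" and ?q = "slice False u"
    have pq: "same_marginals Fs ?p ?q" using kernel[of u] u w by simp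
    have size: "size u = size ?p + size ?q" by (rule size_slice_bool)
    \<comment> \<open>\<open>?p\<close> and \<open>?q\<close> have equal size, so \<open>?p\<close>
      is nonempty as soon as \<open>u\<close> is.\<close>
    have "size w = size u" using u by auto
    then have "?p \<noteq> {#} \<and> size ?p \<le> K"
      using w size same_marginals_size[OF pq \<open>Fs \<noteq> {}\<close>]
      by (metis add_is_0 le_add1 order_trans size_eq_0_iff_empty)
    moreover have "?p \<subseteq># x" "?q \<subseteq># y" using slice_mono[OF u(1)] v by metis+
    ultimately show "\<exists>p q. p \<subseteq># x \<and> q \<subseteq># y \<and> p \<noteq> {#} \<and> size p \<le> K \<and> same_marginals Fs p q"
      using pq by blast
  qed
qed

text \<open>Exchange \<open>p\<close> for \<open>q\<close> inside \<open>x\<close>: the new table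
  keeps the rest of \<open>x\<close> and shares \<open>q\<close> with \<open>y\<close>. The bound on
  the size of \<open>p\<close> makes the rest nonempty once \<open>x\<close> has more than
  \<open>K\<close> cells.\<close>

lemma bounded_middle_table:
  assumes "finite V" and "\<And>F. F \<in> Fs \<Longrightarrow> F \<subseteq> V" and "Fs \<noteq> {}"
  shows "\<exists>K. \<forall>d' x y. (\<forall>i\<in>V - {j}. d' i = d i) \<longrightarrow> set_mset x \<subseteq> cells V d' \<longrightarrow> set_mset y \<subseteq> cells V d' \<longrightarrow>
     same_marginals Fs x y \<longrightarrow> size x > K \<longrightarrow>
     (\<exists>z. set_mset z \<subseteq> cells V d' \<and> same_marginals Fs x z \<and> x \<inter># z \<noteq> {#} \<and> z \<inter># y \<noteq> {#})"
proof -
  obtain K where K: "\<forall>d' x y. (\<forall>i\<in>V - {j}. d' i = d i) \<longrightarrow> set_mset x \<subseteq> cells V d' \<longrightarrow> set_mset y \<subseteq> cells V d' \<longrightarrow>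
     same_marginals Fs x y \<longrightarrow> x \<noteq> {#} \<longrightarrow>
     (\<exists>p q. p \<subseteq># x \<and> q \<subseteq># y \<and> p \<noteq> {#} \<and> size p \<le> K \<and> same_marginals Fs p q)"
    using bounded_same_marginals[OF assms, where j = j and d = d] by blast
  show ?thesis
  proof (intro exI[of _ K] allI impI)
    fix d' x y
    assume d': "\<forall>i\<in>V - {j}. d' i = d i" and C: "set_mset x \<subseteq> cells V d'" "set_mset y \<subseteq> cells V d'"
      and xy: "same_marginals Fs x y" and "size x > K"
    moreover from this have "x \<noteq> {#}" by auto
    ultimately obtain p q where pq: "p \<subseteq># x" "q \<subseteq># y" "p \<noteq> {#}" "size p \<le> K" "same_marginals Fs p q"
      using K by metis
    obtain x' where x: "x = p + x'" using pq(1) by (metis subset_mset.add_diff_inverse)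
    have "x' \<noteq> {#}" using pq(4) x \<open>size x > K\<close> by auto
    have "q \<noteq> {#}" using same_marginals_size[OF pq(5) assms(3)] pq(3) by auto
    show "\<exists>z. set_mset z \<subseteq> cells V d' \<and> same_marginals Fs x z \<and> x \<inter># z \<noteq> {#} \<and> z \<inter># y \<noteq> {#}"
    proof (intro exI[of _ "q + x'"] conjI)
      show "set_mset (q + x') \<subseteq> cells V d'" using C pq(2) x by (auto dest: mset_subset_eqD)
      show "same_marginals Fs x (q + x')" using pq(5) x by (simp add: same_marginals_union)
      show "x \<inter># (q + x') \<noteq> {#}" using x \<open>x' \<noteq> {#}\<close>
        by (intro inter_mset_nonempty[of x']) auto
      show "(q + x') \<inter># y \<noteq> {#}" using pq(2) \<open>q \<noteq> {#}\<close>
        by (intro inter_mset_nonempty[of q]) auto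
    qed
  qed
qed
section \<open>Redundant moves in Markov bases\<close>

lemma vecs_count:
  fixes t :: "'c \<Rightarrow> nat"
  assumes "finite C" "t \<in> vecs C"
  obtains x where "set_mset x \<subseteq> C" "t = count x"
proof
  have fin: "finite {c. t c > 0}"
    by (rule finite_subset[OF _ assms(1)]) (use assms(2) in \<open>auto simp: vecs_def\<close>)
  show "t = count (Abs_multiset t)" using fin by simp
  then show "set_mset (Abs_multiset t) \<subseteq> C"
    using assms(2) by (auto simp: vecs_def) (metis count_greater_zero_iff less_numeral_extra(3))
qed

lemma count_vecs: "set_mset x \<subseteq> C \<Longrightarrow> count x \<in> vecs C"
  by (auto simp: vecs_def count_eq_zero_iff)

text \<open>Since both sides are multisets, the nonnegativity demanded along a path in
  \<open>connects\<close> is built in, and connectivity becomes the closure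
  \<open>(mstep C M)\<^sup>*\<^sup>*\<close>.\<close>

definition mstep :: "'c set \<Rightarrow> ('c \<Rightarrow> int) set \<Rightarrow> 'c multiset \<Rightarrow> 'c multiset \<Rightarrow> bool" where
  "mstep C M x y \<longleftrightarrow> set_mset x \<subseteq> C \<and> set_mset y \<subseteq> C \<and>
     (\<exists>w\<in>M. \<forall>c\<in>C. int (count x c) + w c = int (count y c))"

lemma mset_from_counts:
  assumes "finite C"
  obtains x where "set_mset x \<subseteq> C" "\<And>c. c \<in> C \<Longrightarrow> count x c = f c"
proof -
  have "(\<lambda>c. if c \<in> C then f c else 0) \<in> vecs C" by (simp add: vecs_def)
  then obtain x where x: "set_mset x \<subseteq> C" "(\<lambda>c. if c \<in> C then f c else 0) = count x"
    by (rule vecs_count[OF assms])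
  then show thesis using that[OF x(1)] fun_cong[OF x(2)] by metis
qed

lemma connects_imp_mstep:
  assumes "finite C" and x: "set_mset x \<subseteq> C" and y: "set_mset y \<subseteq> C" and "connects C M (count x) (count y)"
  shows "(mstep C M)\<^sup>*\<^sup>* x y"
proof -
  obtain vs where "set vs \<subseteq> M"
    "\<forall>p\<in>{1..length vs}. \<forall>c\<in>C. int (count x c) + (\<Sum>i<p. (vs ! i) c) \<ge> 0"
    "\<forall>c\<in>C. int (count x c) + (\<Sum>i<length vs. (vs ! i) c) = int (count y c)"
    using assms(4) by (auto simp: connects_def)
  then show ?thesis using x
  proof (induction vs arbitrary: x)
    case Nil
    then have "count x c = count y c" if "c \<in> C" for c using that by simp
    moreover have "count x c = count y c" if "c \<notin> C" for c
      using that y Nil.prems(4) by (metis count_eq_zero_iff subsetD)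
    ultimately have "x = y" by (metis multiset_eqI)
    then show ?case by simp
  next
    case (Cons w vs)
    obtain x' where x': "set_mset x' \<subseteq> C" "\<And>c. c \<in> C \<Longrightarrow> count x' c = nat (int (count x c) + w c)"
      using mset_from_counts[OF assms(1), where f = "\<lambda>c. nat (int (count x c) + w c)"] by blast
    \<comment> \<open>This is the path condition at \<open>p = 1\<close>; hence \<open>nat\<close>
      truncates nothing in the choice of \<open>x'\<close>.\<close>
    have "int (count x c) + w c \<ge> 0" if "c \<in> C" for c
      using Cons.prems(2)[rule_format, of 1 c] that by simp
    then have w: "int (count x' c) = int (count x c) + w c" if "c \<in> C" for c
      using that x' by simp
    then have "mstep C M x x'" using x' Cons.prems by (auto simp: mstep_def intro!: bexI[of _ w])
    moreover have "(mstep C M)\<^sup>*\<^sup>* x' y"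
    proof (rule Cons.IH)
      show "set vs \<subseteq> M" using Cons.prems by simp
      show "\<forall>p\<in>{1..length vs}. \<forall>c\<in>C. int (count x' c) + (\<Sum>i<p. (vs ! i) c) \<ge> 0"
      proof (intro ballI)
        fix p c assume "p \<in> {1..length vs}" "c \<in> C"
        then show "int (count x' c) + (\<Sum>i<p. (vs ! i) c) \<ge> 0"
          using Cons.prems(2)[rule_format, of "Suc p" c] w by (simp add: sum.lessThan_Suc_shift add.assoc del: sum.lessThan_Suc)
      qed
      show "\<forall>c\<in>C. int (count x' c) + (\<Sum>i<length vs. (vs ! i) c) = int (count y c)"
        using Cons.prems(3) w by (simp add: sum.lessThan_Suc_shift add.assoc del: sum.lessThan_Suc)
      show "set_mset x' \<subseteq> C" by fact
    qed
    ultimately show ?case by simp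
  qed
qed

lemma mstep_imp_connects:
  assumes "(mstep C M)\<^sup>*\<^sup>* x y"
  shows "connects C M (count x) (count y)"
  using assms
proof (induction rule: converse_rtranclp_induct)
  case base
  show ?case unfolding connects_def by (intro exI[of _ "[]"]) simp
next
  case (step x x')
  then obtain w where w: "w \<in> M" "\<And>c. c \<in> C \<Longrightarrow> int (count x c) + w c = int (count x' c)"
    by (auto simp: mstep_def)
  obtain vs where vs: "set vs \<subseteq> M"
    "\<forall>p\<in>{1..length vs}. \<forall>c\<in>C. int (count x' c) + (\<Sum>i<p. (vs ! i) c) \<ge> 0"
    "\<forall>c\<in>C. int (count x' c) + (\<Sum>i<length vs. (vs ! i) c) = int (count y c)"
    using step.IH by (auto simp: connects_def)
  have sum: "int (count x c) + (\<Sum>i<Suc p. ((w # vs) ! i) c) = int (count x' c) + (\<Sum>i<p. (vs ! i) c)"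
    if "c \<in> C" for c p
    using w(2)[OF that] by (simp add: sum.lessThan_Suc_shift del: sum.lessThan_Suc)
  show ?case unfolding connects_def
  proof (intro exI[of _ "w # vs"] conjI ballI)
    show "set (w # vs) \<subseteq> M" using w vs by simp
    fix c assume c: "c \<in> C"
    show "int (count x c) + (\<Sum>i<length (w # vs). ((w # vs) ! i) c) = int (count y c)"
      using sum[OF c, of "length vs"] vs(3) c by simp
    fix p assume p: "p \<in> {1..length (w # vs)}"
    then obtain p' where p': "p = Suc p'" "p' \<le> length vs" by (cases p) auto
    \<comment> \<open>\<open>vs(2)\<close> starts at one; for \<open>p' = 0\<close> the value is
      just the multiplicity in \<open>x'\<close>.\<close>
    show "int (count x c) + (\<Sum>i<p. ((w # vs) ! i) c) \<ge> 0"
      unfolding p' sum[OF c] using vs(2) c p' by (cases "p' = 0") auto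
  qed
qed

lemma mstep_add:
  assumes "(mstep C M)\<^sup>*\<^sup>* x y" "set_mset z \<subseteq> C"
  shows "(mstep C M)\<^sup>*\<^sup>* (x + z) (y + z)"
  using assms(1)
proof induction
  case (step y y')
  then have "mstep C M (y + z) (y' + z)" using assms(2) by (fastforce simp: mstep_def)
  with step show ?case by simp
qed simp

definition same_fibre :: "'r set \<Rightarrow> 'c set \<Rightarrow> ('r \<Rightarrow> 'c \<Rightarrow> nat) \<Rightarrow> 'c multiset \<Rightarrow> 'c multiset \<Rightarrow> bool" where
  "same_fibre R C A x y \<longleftrightarrow> set_mset x \<subseteq> C \<and> set_mset y \<subseteq> C \<and>
     (\<forall>r\<in>R. mat_apply C A (count x) r = mat_apply C A (count y) r)"

lemma mat_apply_count_add:
  "mat_apply C A (count (x + y)) r = mat_apply C A (count x) r + mat_apply C A (count y) r"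
  by (simp add: mat_apply_def sum.distrib algebra_simps)

lemma int_mat_apply: "int (mat_apply C A (count x) r) = mat_apply C A (\<lambda>c. int (count x c)) r"
  by (simp add: mat_apply_def)

lemma markov_basis_iff_mstep:
  fixes C :: "'c set" and M :: "('c \<Rightarrow> int) set"
  assumes "finite C"
  shows "markov_basis R C A M \<longleftrightarrow> finite M \<and> M \<subseteq> int_kernel R C A \<and>
     (\<forall>x y. same_fibre R C A x y \<longrightarrow> (mstep C M)\<^sup>*\<^sup>* x y)" (is "_ \<longleftrightarrow> ?r")
proof
  assume "markov_basis R C A M"
  then show ?r
    using connects_imp_mstep[OF assms] by (auto simp: markov_basis_def same_fibre_def count_vecs)
next
  assume r: ?r
  show "markov_basis R C A M"
    unfolding markov_basis_def
  proof (intro conjI ballI impI)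
    fix t u :: "'c \<Rightarrow> nat"
    assume "t \<in> vecs C" "u \<in> vecs C" "\<forall>r\<in>R. mat_apply C A t r = mat_apply C A u r"
    moreover from this obtain x y where "set_mset x \<subseteq> C" "t = count x" "set_mset y \<subseteq> C" "u = count y"
      using vecs_count[OF assms] by metis
    ultimately show "connects C M t u"
      using r mstep_imp_connects[of C M x y] unfolding same_fibre_def by blast
  qed (use r in auto)
qed

text \<open>A move whose negative part is linked to its positive part by tables with overlapping
  supports is redundant: cancelling a common cell leaves tables of smaller size, where the move
  itself is not applicable.\<close>

lemma minimal_markov_basis_not_linked:
  assumes "finite C" and min: "minimal_markov_basis R C A M" and "v \<in> M"
    and homogeneous: "\<And>x y. same_fibre R C A x y \<Longrightarrow> size x = size y"
    and x: "set_mset x \<subseteq> C" "\<And>c. c \<in> C \<Longrightarrow> count x c = nat (- v c)"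
    and y: "set_mset y \<subseteq> C" "\<And>c. c \<in> C \<Longrightarrow> count y c = nat (v c)"
  shows "\<not> (\<lambda>s t. same_fibre R C A s t \<and> s \<inter># t \<noteq> {#})\<^sup>*\<^sup>* x y"
proof
  let ?link = "\<lambda>s t. same_fibre R C A s t \<and> s \<inter># t \<noteq> {#}"
  let ?N = "M - {v}"
  have mb: "finite M" "M \<subseteq> int_kernel R C A" "\<And>s t. same_fibre R C A s t \<Longrightarrow> (mstep C M)\<^sup>*\<^sup>* s t"
    using min by (auto simp: minimal_markov_basis_def markov_basis_iff_mstep[OF assms(1)])
  assume link: "?link\<^sup>*\<^sup>* x y"
  have fibre_step: "same_fibre R C A s t" if "mstep C M s t" for s t
  proof -
    obtain w where w: "w \<in> M" "\<And>c. c \<in> C \<Longrightarrow> int (count s c) + w c = int (count t c)"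
      and st: "set_mset s \<subseteq> C" "set_mset t \<subseteq> C"
      using \<open>mstep C M s t\<close> by (auto simp: mstep_def)
    have "mat_apply C A (count s) r = mat_apply C A (count t) r" if "r \<in> R" for r
    proof -
      have "mat_apply C A (\<lambda>c. int (count t c)) r = mat_apply C A (\<lambda>c. int (count s c)) r + mat_apply C A w r"
        by (simp add: mat_apply_def sum.distrib[symmetric] w(2)[symmetric] algebra_simps cong: sum.cong)
      moreover have "mat_apply C A w r = 0" using mb(2) w(1) that by (auto simp: int_kernel_def)
      ultimately show ?thesis by (simp flip: int_mat_apply)
    qed
    with st show ?thesis by (simp add: same_fibre_def)
  qed
  \<comment> \<open>Applying \<open>v\<close> means removing its negative part \<open>x\<close> and
    inserting its positive part \<open>y\<close>, so a table smaller than \<open>x\<close> does not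
    admit it.\<close>
  have applicable: "x \<subseteq># s \<and> t = y + (s - x)"
    if "set_mset s \<subseteq> C" "set_mset t \<subseteq> C" "\<forall>c\<in>C. int (count s c) + v c = int (count t c)" for s t
  proof
    have out: "count u c = 0" if "c \<notin> C" "set_mset u \<subseteq> C" for u c
      using that by (auto simp: count_eq_zero_iff)
    show "x \<subseteq># s"
    proof (rule mset_subset_eqI)
      fix c show "count x c \<le> count s c"
        using that x out[of c x] by (cases "c \<in> C") force+
    qed
    show "t = y + (s - x)"
    proof (rule multiset_eqI)
      fix c show "count t c = count (y + (s - x)) c"
      proof (cases "c \<in> C")
        case True
        then have "int (count s c) + v c = int (count t c)" using that(3) by blast
        then show ?thesis using x(2)[OF True] y(2)[OF True] by simp
      next
        case False
        then show ?thesis using out that(1,2) x(1) y(1) by simp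
      qed
    qed
  qed
  \<comment> \<open>Fibres have constant size, so a path starting below the size of \<open>x\<close>
    never meets a table containing \<open>x\<close> and hence never uses \<open>v\<close>.\<close>
  have avoid: "(mstep C ?N)\<^sup>*\<^sup>* s t" if st: "(mstep C M)\<^sup>*\<^sup>* s t" and small: "size s < size x" for s t
  proof -
    have "(mstep C ?N)\<^sup>*\<^sup>* s t \<and> size t = size s"
      using st
    proof induction
      case base then show ?case by simp
    next
      case (step t t')
      have "\<not> x \<subseteq># t" using step.IH small by (auto dest: size_mset_mono)
      then have "mstep C ?N t t'"
        using step.hyps(2) applicable[of t t'] unfolding mstep_def by blast
      moreover have "size t' = size t" using homogeneous fibre_step step.hyps(2) by metis
      ultimately show ?case using step.IH by auto
    qed
    then show ?thesis by simp
  qed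
  \<comment> \<open>Remove a common cell \<open>c\<close>, join the smaller remainders without
    \<open>v\<close>, and add \<open>c\<close> back.\<close>
  have linked: "(mstep C ?N)\<^sup>*\<^sup>* s t" if st: "?link s t" "size s = size x" for s t
  proof -
    obtain c where "c \<in># s" "c \<in># t" using st(1) by (auto elim!: multiset_nonemptyE)
    then obtain s' t' where s': "s = s' + {#c#}" and t': "t = t' + {#c#}"
      by (metis add_mset_add_single insert_DiffM)
    have "same_fibre R C A s' t'" "set_mset {#c#} \<subseteq> C"
      using st(1) unfolding same_fibre_def s' t' mat_apply_count_add by auto
    moreover have "size s' < size x" using st(2) s' by simp
    ultimately show ?thesis using mstep_add[OF avoid[OF mb(3)]] s' t' by blast
  qed
  have "(mstep C ?N)\<^sup>*\<^sup>* x t \<and> size t = size x" if "?link\<^sup>*\<^sup>* x t" for t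
    using that
  proof induction
    case base then show ?case by simp
  next
    case (step t t')
    then have "size t' = size x" using homogeneous by metis
    with step linked show ?case by (meson rtranclp_trans)
  qed
  then have xy: "(mstep C ?N)\<^sup>*\<^sup>* x y" using link by blast
  \<comment> \<open>Each use of \<open>v\<close> is replaced by the path from \<open>x\<close> to
    \<open>y\<close>, translated by the untouched part \<open>s - x\<close>.\<close>
  have replace: "(mstep C ?N)\<^sup>*\<^sup>* s t" if "mstep C M s t" for s t
  proof (cases "mstep C ?N s t")
    case False
    then have st: "set_mset s \<subseteq> C" "set_mset t \<subseteq> C" "\<forall>c\<in>C. int (count s c) + v c = int (count t c)"
      using that unfolding mstep_def by blast+
    then have "x \<subseteq># s" "t = y + (s - x)" using applicable by blast+
    moreover have "set_mset (s - x) \<subseteq> C" using st(1) by (auto dest: in_diffD)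
    ultimately show ?thesis using mstep_add[OF xy, of "s - x"] by simp
  qed auto
  have "(mstep C ?N)\<^sup>*\<^sup>* s t" if "(mstep C M)\<^sup>*\<^sup>* s t" for s t
    using that by induction (auto intro: rtranclp_trans dest: replace)
  then have "markov_basis R C A ?N"
    using mb by (auto simp: markov_basis_iff_mstep[OF assms(1)])
  moreover have "?N \<subset> M" using \<open>v \<in> M\<close> by blast
  ultimately show False using min by (simp add: minimal_markov_basis_def)
qed
section \<open>Gluing tables of a reducible complex\<close>

text \<open>For \<open>Fs\<close> the whole complex this is the link relation of
  \<open>minimal_markov_basis_not_linked\<close>, by \<open>same_fibre_marginal_matrix\<close>.
  General \<open>Fs\<close> and \<open>C\<close> keep the gluing arguments free of matrices.\<close>

definition overlap ::
  "nat set set \<Rightarrow> (nat \<Rightarrow> nat) set \<Rightarrow> (nat \<Rightarrow> nat) multiset \<Rightarrow> (nat \<Rightarrow> nat) multiset \<Rightarrow> bool" where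
  "overlap Fs C x y \<longleftrightarrow>
     set_mset x \<subseteq> C \<and> set_mset y \<subseteq> C \<and> same_marginals Fs x y \<and> x \<inter># y \<noteq> {#}"

lemma glue_cells:
  assumes c: "c1 \<in> cells V1 d" "c2 \<in> cells V2 d"
    and eq: "restrict c1 (V1 \<inter> V2) = restrict c2 (V1 \<inter> V2)"
  obtains c where "c \<in> cells (V1 \<union> V2) d" "restrict c V1 = c1" "restrict c V2 = c2"
proof
  \<comment> \<open>Outside both sets the value is that of \<open>c2\<close>, which is
    \<open>undefined\<close> there, so the glued function is extensional.\<close>
  let ?c = "\<lambda>j. if j \<in> V1 then c1 j else c2 j"
  have eq': "c1 j = c2 j" if "j \<in> V1" "j \<in> V2" for j
    using fun_cong[OF eq, of j] that by simp
  show "?c \<in> cells (V1 \<union> V2) d"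
    using c by (auto simp: cells_def PiE_iff extensional_def)
  show "restrict ?c V1 = c1" using c by (auto simp: cells_def PiE_iff extensional_def restrict_def)
  show "restrict ?c V2 = c2"
    using c eq' by (auto simp: cells_def PiE_iff extensional_def restrict_def fun_eq_iff)
qed

lemma restrict_inj_Un:
  assumes "c \<in> cells (V1 \<union> V2) d" "c' \<in> cells (V1 \<union> V2) d"
    and "restrict c V1 = restrict c' V1" "restrict c V2 = restrict c' V2"
  shows "c = c'"
proof
  fix j show "c j = c' j"
    using assms(1,2) fun_cong[OF assms(3), of j] fun_cong[OF assms(4), of j]
    by (cases "j \<in> V1"; cases "j \<in> V2") (auto simp: cells_def PiE_iff extensional_def)
qed

text \<open>Equal marginals over \<open>V1 \<inter> V2\<close> allow the cells of \<open>x1\<close>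
  and \<open>x2\<close> to be paired so that partners agree on the intersection; the pairs are glued
  one by one.\<close>

lemma glue_tables:
  assumes "set_mset x1 \<subseteq> cells V1 d" "set_mset x2 \<subseteq> cells V2 d"
    and "image_mset (\<lambda>c. restrict c (V1 \<inter> V2)) x1 = image_mset (\<lambda>c. restrict c (V1 \<inter> V2)) x2"
  shows "\<exists>x. set_mset x \<subseteq> cells (V1 \<union> V2) d \<and> image_mset (\<lambda>c. restrict c V1) x = x1 \<and>
     image_mset (\<lambda>c. restrict c V2) x = x2"
  using assms
proof (induction x1 arbitrary: x2)
  case empty
  then show ?case by (intro exI[of _ "{#}"]) auto
next
  case (add c1 x1)
  from add.prems(3) obtain x2' c2 where x2: "x2 = add_mset c2 x2'"
      "restrict c2 (V1 \<inter> V2) = restrict c1 (V1 \<inter> V2)"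
      "image_mset (\<lambda>c. restrict c (V1 \<inter> V2)) x2' = image_mset (\<lambda>c. restrict c (V1 \<inter> V2)) x1"
    by (metis (no_types, lifting) image_mset_add_mset msed_map_invR)
  then obtain c where "c \<in> cells (V1 \<union> V2) d" "restrict c V1 = c1" "restrict c V2 = c2"
    using glue_cells[of c1 V1 d c2 V2] add.prems by auto
  moreover have "set_mset x1 \<subseteq> cells V1 d" "set_mset x2' \<subseteq> cells V2 d" using add.prems x2(1) by auto
  then obtain x where "set_mset x \<subseteq> cells (V1 \<union> V2) d" "image_mset (\<lambda>c. restrict c V1) x = x1"
      "image_mset (\<lambda>c. restrict c V2) x = x2'"
    using add.IH[OF _ _ x2(3)[symmetric]] by blast
  ultimately show ?case using x2(1) 
    by (intro exI[of _ "add_mset c x"] conjI)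
       (simp_all only: image_mset_add_mset set_mset_add_mset_insert insert_subset simp_thms)
qed

text \<open>A marginal over a subset of \<open>V1\<close> or \<open>V2\<close> factors through the
  marginal over that side.\<close>

lemma same_marginals_Un:
  assumes "\<forall>F\<in>Fs. F \<subseteq> V1 \<or> F \<subseteq> V2"
    and "same_marginals {F \<in> Fs. F \<subseteq> V1} (image_mset (\<lambda>c. restrict c V1) x) (image_mset (\<lambda>c. restrict c V1) y)"
    and "same_marginals {F \<in> Fs. F \<subseteq> V2} (image_mset (\<lambda>c. restrict c V2) x) (image_mset (\<lambda>c. restrict c V2) y)"
  shows "same_marginals Fs x y"
  unfolding same_marginals_def
proof
  fix F assume "F \<in> Fs"
  have r: "image_mset (\<lambda>c. restrict c F) (image_mset (\<lambda>c. restrict c V) z) = image_mset (\<lambda>c. restrict c F) z"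
    if "F \<subseteq> V" for V and z :: "(nat \<Rightarrow> nat) multiset"
    using that by (simp add: image_mset.compositionality comp_def Int_absorb1)
  show "image_mset (\<lambda>c. restrict c F) x = image_mset (\<lambda>c. restrict c F) y"
    using assms \<open>F \<in> Fs\<close> r[of V1] r[of V2] unfolding same_marginals_def
    by (metis (mono_tags, lifting) mem_Collect_eq)
qed

lemma same_marginals_restrict:
  assumes "same_marginals Fs x y"
  shows "same_marginals {F \<in> Fs. F \<subseteq> V} (image_mset (\<lambda>c. restrict c V) x) (image_mset (\<lambda>c. restrict c V) y)"
  using assms by (auto simp: same_marginals_def image_mset.compositionality comp_def Int_absorb1)

text \<open>Lifts a link in the \<open>V1\<close> component to the full vertex set without changing
  the \<open>V2\<close> side. The shared cell of the component comes from a cell of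
  \<open>w\<close>, which is kept while the rest is glued anew.\<close>

lemma overlap_lift:
  assumes Fs: "\<forall>F\<in>Fs. F \<subseteq> V1 \<or> F \<subseteq> V2" and S: "V1 \<inter> V2 \<in> Fs"
    and w: "set_mset w \<subseteq> cells (V1 \<union> V2) d" and z1: "set_mset z1 \<subseteq> cells V1 d"
    and marg: "same_marginals {F \<in> Fs. F \<subseteq> V1} (image_mset (\<lambda>c. restrict c V1) w) z1"
    and meet: "image_mset (\<lambda>c. restrict c V1) w \<inter># z1 \<noteq> {#}"
  shows "\<exists>z. overlap Fs (cells (V1 \<union> V2) d) w z \<and> image_mset (\<lambda>c. restrict c V1) z = z1 \<and>
     image_mset (\<lambda>c. restrict c V2) z = image_mset (\<lambda>c. restrict c V2) w"
proof -
  let ?r = "\<lambda>W. image_mset (\<lambda>c. restrict c W)"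
  let ?S = "V1 \<inter> V2"
  obtain c1 where "c1 \<in># ?r V1 w \<inter># z1" using meet by (meson multiset_nonemptyE)
  then obtain c where c: "c \<in># w" "restrict c V1 \<in># z1" by auto
  obtain w' where w': "w = add_mset c w'" using c(1) by (metis insert_DiffM)
  obtain z1' where z1': "z1 = add_mset (restrict c V1) z1'" using c(2) by (metis insert_DiffM)
  \<comment> \<open>The intersection belongs to \<open>Fs\<close>, so the marginals over it agree;
    deleting the contribution of \<open>c\<close> on both sides keeps them equal, and the remainders
    can be glued.\<close>
  have "?r ?S (?r V1 w) = ?r ?S z1"
    using marg S by (auto simp: same_marginals_def)
  then have "?r ?S z1' = ?r ?S (?r V2 w')"
    by (simp add: w' z1' image_mset.compositionality comp_def Int_ac)
  moreover have "set_mset (?r V2 w') \<subseteq> cells V2 d" "set_mset z1' \<subseteq> cells V1 d"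
    using w z1 w' z1' by (auto intro: restrict_cells)
  ultimately obtain z' where z': "set_mset z' \<subseteq> cells (V1 \<union> V2) d" "?r V1 z' = z1'" "?r V2 z' = ?r V2 w'"
    using glue_tables[of z1' V1 d "?r V2 w'" V2] by blast
  let ?z = "add_mset c z'"
  have z: "?r V1 ?z = z1" "?r V2 ?z = ?r V2 w" by (simp_all add: w' z1' z')
  have "same_marginals Fs w ?z"
    by (rule same_marginals_Un[OF Fs]) (simp_all only: z marg same_marginals_refl)
  moreover have "w \<inter># ?z \<noteq> {#}" by (rule inter_mset_nonempty[of "{#c#}"]) (simp_all add: w')
  ultimately have "overlap Fs (cells (V1 \<union> V2) d) w ?z"
    using w w' z' by (simp add: overlap_def)
  with z show ?thesis by blast
qed

text \<open>Two tables with the same marginals on both sides are linked by exchanging the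
  \<open>V2\<close>-parts of two cells; a third cell stays untouched, whence the bound on the size.\<close>

lemma overlap_swap:
  assumes Fs: "\<forall>F\<in>Fs. F \<subseteq> V1 \<or> F \<subseteq> V2"
    and x: "set_mset x \<subseteq> cells (V1 \<union> V2) d" and y: "set_mset y \<subseteq> cells (V1 \<union> V2) d"
    and eq1: "image_mset (\<lambda>c. restrict c V1) x = image_mset (\<lambda>c. restrict c V1) y"
    and eq2: "image_mset (\<lambda>c. restrict c V2) x = image_mset (\<lambda>c. restrict c V2) y"
    and size: "size x > 2"
  shows "(overlap Fs (cells (V1 \<union> V2) d))\<^sup>*\<^sup>* x y"
proof -
  let ?r = "\<lambda>W. image_mset (\<lambda>c. restrict c W)"
  let ?C = "cells (V1 \<union> V2) d"
  have ov: "overlap Fs ?C u u'" if "set_mset u \<subseteq> ?C" "set_mset u' \<subseteq> ?C" "?r V1 u = ?r V1 u'" "?r V2 u = ?r V2 u'"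
      "u \<inter># u' \<noteq> {#}" for u u'
    using that same_marginals_Un[OF Fs, of u u'] by (simp add: overlap_def)
  have "x \<noteq> {#}" using size by auto
  then obtain c where c: "c \<in># x" by (meson multiset_nonemptyE)
  \<comment> \<open>In \<open>y\<close>, the cell \<open>p\<close> has the \<open>V1\<close>-part of
    \<open>c\<close>, and \<open>q\<close> has its \<open>V2\<close>-part.\<close>
  have "restrict c V1 \<in># ?r V1 y" using c eq1[symmetric] by simp
  then obtain p where p: "p \<in># y" "restrict p V1 = restrict c V1" by auto
  have "restrict c V2 \<in># ?r V2 y" using c eq2[symmetric] by simp
  then obtain q where q: "q \<in># y" "restrict q V2 = restrict c V2" by auto
  have C: "c \<in> ?C" "p \<in> ?C" "q \<in> ?C" using c p q x y by auto
  show ?thesis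
  proof (cases "p = q")
    case True
    then have "c = p" using restrict_inj_Un[OF C(1,2)] p q by simp
    then have "x \<inter># y \<noteq> {#}" using c p by (intro inter_mset_nonempty[of "{#c#}"]) auto
    then show ?thesis using ov x y eq1 eq2 by blast
  next
    case False
    then obtain y' where y': "y = add_mset p (add_mset q y')"
      using p(1) q(1) by (metis insert_DiffM insert_noteq_member)
    have "size x = size y" using eq1 by (metis size_image_mset)
    then have "y' \<noteq> {#}" using size y' by auto
    have "restrict (restrict q V1) (V1 \<inter> V2) = restrict (restrict p V2) (V1 \<inter> V2)"
    proof -
      have "q j = p j" if "j \<in> V1" "j \<in> V2" for j
        using fun_cong[OF p(2), of j] fun_cong[OF q(2), of j] that by simp
      then show ?thesis by (auto simp: restrict_def)
    qed
    moreover have "restrict q V1 \<in> cells V1 d" "restrict p V2 \<in> cells V2 d"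
      using C by (auto intro: restrict_cells)
    ultimately obtain e where e: "e \<in> ?C" "restrict e V1 = restrict q V1" "restrict e V2 = restrict p V2"
      using glue_cells by metis
    \<comment> \<open>In \<open>y\<close>, replace \<open>p\<close> and \<open>q\<close> by
      \<open>c\<close> and \<open>e\<close>. The same halves are recombined, so the marginals over
      \<open>V1\<close> and \<open>V2\<close> persist.\<close>
    let ?z = "add_mset c (add_mset e y')"
    have z: "?r V1 ?z = ?r V1 y" "?r V2 ?z = ?r V2 y"
      using p q e by (simp_all add: y' add_mset_commute)
    have zC: "set_mset ?z \<subseteq> ?C" using C e y y' by auto
    have "x \<inter># ?z \<noteq> {#}" using c by (intro inter_mset_nonempty[of "{#c#}"]) auto
    then have "overlap Fs ?C x ?z" using z zC x eq1 eq2 by (intro ov) auto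
    moreover have "?z \<inter># y \<noteq> {#}" using \<open>y' \<noteq> {#}\<close> y'
      by (intro inter_mset_nonempty[of y']) (simp_all add: subseteq_mset_def)
    then have "overlap Fs ?C ?z y" using z zC y by (intro ov) auto
    ultimately show ?thesis by auto
  qed
qed

text \<open>Two links through a lifted middle table bring the \<open>V1\<close> side of
  \<open>x\<close> to that of \<open>y\<close>, and two more do the same for the \<open>V2\<close>
  side. The table reached has both side marginals of \<open>y\<close>, and
  \<open>overlap_swap\<close> closes the chain.\<close>

lemma overlap_connected:
  assumes "finite V1" "finite V2"
    and Fs: "\<forall>F\<in>Fs. F \<subseteq> V1 \<or> F \<subseteq> V2" and S: "V1 \<inter> V2 \<in> Fs"
  shows "\<exists>K. \<forall>d' x y. (\<forall>i\<in>V1 - {j1}. d' i = d i) \<longrightarrow> (\<forall>i\<in>V2 - {j2}. d' i = d i) \<longrightarrow>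
     set_mset x \<subseteq> cells (V1 \<union> V2) d' \<longrightarrow> set_mset y \<subseteq> cells (V1 \<union> V2) d' \<longrightarrow> same_marginals Fs x y \<longrightarrow>
     size x > K \<longrightarrow> (overlap Fs (cells (V1 \<union> V2) d'))\<^sup>*\<^sup>* x y"
proof -
  let ?r = "\<lambda>W. image_mset (\<lambda>c. restrict c W)"
  let ?F = "\<lambda>V. {F \<in> Fs. F \<subseteq> V}"
  have "?F V1 \<noteq> {}" "?F V2 \<noteq> {}" using S by auto
  then obtain K1 K2 where
    K1: "\<forall>d' x y. (\<forall>i\<in>V1 - {j1}. d' i = d i) \<longrightarrow> set_mset x \<subseteq> cells V1 d' \<longrightarrow> set_mset y \<subseteq> cells V1 d' \<longrightarrow>
     same_marginals (?F V1) x y \<longrightarrow> size x > K1 \<longrightarrow>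
     (\<exists>z. set_mset z \<subseteq> cells V1 d' \<and> same_marginals (?F V1) x z \<and> x \<inter># z \<noteq> {#} \<and> z \<inter># y \<noteq> {#})" and
    K2: "\<forall>d' x y. (\<forall>i\<in>V2 - {j2}. d' i = d i) \<longrightarrow> set_mset x \<subseteq> cells V2 d' \<longrightarrow> set_mset y \<subseteq> cells V2 d' \<longrightarrow>
     same_marginals (?F V2) x y \<longrightarrow> size x > K2 \<longrightarrow>
     (\<exists>z. set_mset z \<subseteq> cells V2 d' \<and> same_marginals (?F V2) x z \<and> x \<inter># z \<noteq> {#} \<and> z \<inter># y \<noteq> {#})"
    using bounded_middle_table[OF \<open>finite V1\<close>, of "?F V1" j1 d] bounded_middle_table[OF \<open>finite V2\<close>, of "?F V2" j2 d]
    by auto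
  show ?thesis
  \<comment> \<open>The 2 serves the final swap; \<open>K1\<close> and \<open>K2\<close> serve the
    middle tables, since restricting the cells of a table preserves its size.\<close>
  proof (intro exI[of _ "max 2 (max K1 K2)"] allI impI)
    fix d' x y
    let ?C = "cells (V1 \<union> V2) d'"
    assume d': "\<forall>i\<in>V1 - {j1}. d' i = d i" "\<forall>i\<in>V2 - {j2}. d' i = d i"
      and x: "set_mset x \<subseteq> ?C" and y: "set_mset y \<subseteq> ?C"
      and xy: "same_marginals Fs x y" and size: "size x > max 2 (max K1 K2)"
    have C: "set_mset (?r V1 u) \<subseteq> cells V1 d'" "set_mset (?r V2 u) \<subseteq> cells V2 d'" if "set_mset u \<subseteq> ?C" for u
      using that by (auto intro: restrict_cells)
    have Fs': "\<forall>F\<in>Fs. F \<subseteq> V2 \<or> F \<subseteq> V1" and S': "V2 \<inter> V1 \<in> Fs" using Fs S by (auto simp: Int_commute)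
    obtain z1 where z1: "set_mset z1 \<subseteq> cells V1 d'" "same_marginals (?F V1) (?r V1 x) z1"
        "?r V1 x \<inter># z1 \<noteq> {#}" "z1 \<inter># ?r V1 y \<noteq> {#}"
      using K1[rule_format, OF _ C(1)[OF x] C(1)[OF y] same_marginals_restrict[OF xy]] d'(1) size by auto
    obtain z2 where z2: "set_mset z2 \<subseteq> cells V2 d'" "same_marginals (?F V2) (?r V2 x) z2"
        "?r V2 x \<inter># z2 \<noteq> {#}" "z2 \<inter># ?r V2 y \<noteq> {#}"
      using K2[rule_format, OF _ C(2)[OF x] C(2)[OF y] same_marginals_restrict[OF xy]] d'(2) size by auto
    have xy1: "same_marginals (?F V1) z1 (?r V1 y)"
      using z1(2) same_marginals_restrict[OF xy, of V1] same_marginals_sym same_marginals_trans by blast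
    have xy2: "same_marginals (?F V2) z2 (?r V2 y)"
      using z2(2) same_marginals_restrict[OF xy, of V2] same_marginals_sym same_marginals_trans by blast
    have ovD: "set_mset v \<subseteq> ?C" if "overlap Fs ?C u v" for u v using that by (simp add: overlap_def)
    obtain a where a: "overlap Fs ?C x a" "?r V1 a = z1" "?r V2 a = ?r V2 x"
      using overlap_lift[OF Fs S x z1(1-3)] by blast
    obtain b where b: "overlap Fs ?C a b" "?r V1 b = ?r V1 y" "?r V2 b = ?r V2 x"
      using overlap_lift[OF Fs S ovD[OF a(1)] C(1)[OF y]] a(2,3) xy1 z1(4) by auto
    \<comment> \<open>From here \<open>V1\<close> and \<open>V2\<close> exchange roles, and the
      \<open>V1\<close> side, already that of \<open>y\<close>, is kept.\<close>
    obtain e where e: "overlap Fs ?C b e" "?r V2 e = z2" "?r V1 e = ?r V1 y"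
      using overlap_lift[OF Fs' S', of b d' z2] ovD[OF b(1)] z2 b(2,3) by (auto simp: Un_commute)
    obtain f where f: "overlap Fs ?C e f" "?r V2 f = ?r V2 y" "?r V1 f = ?r V1 y"
      using overlap_lift[OF Fs' S', of e d' "?r V2 y"] ovD[OF e(1)] C(2)[OF y] e(2,3) xy2 z2(4)
      by (auto simp: Un_commute)
    have "size f = size y" using f(2) by (metis size_image_mset)
    also have "\<dots> = size x" using same_marginals_size[OF xy] S by (metis empty_iff)
    finally have "(overlap Fs ?C)\<^sup>*\<^sup>* f y"
      using size by (intro overlap_swap[OF Fs ovD[OF f(1)] y f(3,2)]) simp
    with a(1) b(1) e(1) f(1) show "(overlap Fs ?C)\<^sup>*\<^sup>* x y"
      by (meson converse_rtranclp_into_rtranclp)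
  qed
qed

section \<open>The marginal matrix and the final bound\<close>

lemma marginal_count:
  assumes "set_mset x \<subseteq> cells {1..n} d"
  shows "marginal n d (count x) (F, b) = count (image_mset (\<lambda>c. restrict c F) x) b"
proof -
  have "marginal n d (count x) (F, b) = sum (count x) {i \<in> cells {1..n} d. restrict i F = b}"
    by (simp add: marginal_def)
  also have "\<dots> = sum (count x) ((\<lambda>c. restrict c F) -` {b} \<inter> set_mset x)"
    by (rule sum.mono_neutral_right)
       (use assms in \<open>auto simp: finite_cells count_eq_zero_iff intro: finite_subset[OF _ finite_cells[of "{1..n}" d]]\<close>)
  finally show ?thesis by (simp add: count_image_mset)
qed

lemma complex_facet:
  assumes "abstract_simplicial_complex \<Delta>" "F \<in> \<Delta>"
  obtains G where "G \<in> facets \<Delta>" "F \<subseteq> G"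
proof -
  have "finite \<Delta>" using assms by (simp add: abstract_simplicial_complex_def)
  then obtain G where "G \<in> \<Delta>" "F \<subseteq> G" "\<forall>H\<in>\<Delta>. G \<le> H \<longrightarrow> G = H"
    using finite_has_maximal2[of \<Delta> F] assms(2) by blast
  then show thesis using that[of G] by (auto simp: facets_def)
qed

text \<open>The matrix has rows for facets only. Each face lies in a facet and its marginal factors
  through that of the facet, so equality extends to all faces.\<close>

lemma same_fibre_marginal_matrix:
  assumes "complex_on n \<Delta>"
  shows "same_fibre (marginal_index \<Delta> d) (cells {1..n} d) (marginal_matrix n d) x y \<longleftrightarrow>
    set_mset x \<subseteq> cells {1..n} d \<and> set_mset y \<subseteq> cells {1..n} d \<and> same_marginals \<Delta> x y"
proof -
  let ?C = "cells {1..n} d"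
  have "(\<forall>r\<in>marginal_index \<Delta> d. marginal n d (count x) r = marginal n d (count y) r) \<longleftrightarrow> same_marginals \<Delta> x y"
    (is "?l \<longleftrightarrow> ?r") if x: "set_mset x \<subseteq> ?C" and y: "set_mset y \<subseteq> ?C"
  proof
    assume l: ?l
    show ?r unfolding same_marginals_def
    proof
      fix F assume "F \<in> \<Delta>"
      then obtain G where G: "G \<in> facets \<Delta>" "F \<subseteq> G"
        using complex_facet assms by (auto simp: complex_on_def)
      have "G \<subseteq> {1..n}" using G(1) assms by (auto simp: complex_on_def complex_vertices_def facets_def)
      \<comment> \<open>Entries outside \<open>cells G d\<close> have no row in the matrix; they
        vanish for both tables.\<close>
      then have out: "count (image_mset (\<lambda>c. restrict c G) z) b = 0" if "set_mset z \<subseteq> ?C" "b \<notin> cells G d" for z b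
        using that restrict_cells[of _ "{1..n}" d G] by (auto simp: count_eq_zero_iff)
      have "image_mset (\<lambda>c. restrict c G) x = image_mset (\<lambda>c. restrict c G) y"
      proof (rule multiset_eqI)
        fix b
        show "count (image_mset (\<lambda>c. restrict c G) x) b = count (image_mset (\<lambda>c. restrict c G) y) b"
        proof (cases "b \<in> cells G d")
          case True
          then have "(G, b) \<in> marginal_index \<Delta> d" using G(1) by (simp add: marginal_index_def)
          then show ?thesis using l x y by (metis marginal_count)
        next
          case False
          then show ?thesis using out x y by simp
        qed
      qed
      then have "image_mset (\<lambda>c. restrict c F) (image_mset (\<lambda>c. restrict c G) x)
          = image_mset (\<lambda>c. restrict c F) (image_mset (\<lambda>c. restrict c G) y)" by simp
      then show "image_mset (\<lambda>c. restrict c F) x = image_mset (\<lambda>c. restrict c F) y"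
        using G(2) by (simp add: image_mset.compositionality comp_def Int_absorb1)
    qed
  next
    assume ?r
    then show ?l using x y
      by (auto simp: marginal_index_def facets_def same_marginals_def marginal_count)
  qed
  then show ?thesis unfolding same_fibre_def mat_apply_marginal_matrix by blast
qed

lemma card_set_mset_le_size: "card (set_mset x) \<le> size x"
  by (metis finite_set_mset mset_set_set_mset_msubset size_mset_mono size_mset_set)

theorem corollary4p5:
  fixes n :: nat and \<Delta> \<Delta>\<^sub>1 \<Delta>\<^sub>2 :: "nat set set" and S :: "nat set" and d :: "nat \<Rightarrow> nat"
  assumes "complex_on n \<Delta>"
    and "reducible_with \<Delta> \<Delta>\<^sub>1 S \<Delta>\<^sub>2"
    and "1 \<in> complex_vertices \<Delta>\<^sub>1 - complex_vertices \<Delta>\<^sub>2"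
    and "2 \<in> complex_vertices \<Delta>\<^sub>2 - complex_vertices \<Delta>\<^sub>1"
    and "\<forall>j\<in>{3..n}. d j \<ge> 2"
  shows "\<exists>m\<^sub>1 m\<^sub>2. \<forall>d\<^sub>1 d\<^sub>2. d\<^sub>1 \<ge> 2 \<longrightarrow> d\<^sub>2 \<ge> 2 \<longrightarrow>
    (\<forall>v\<in>complex_universal_markov_basis n \<Delta> (d(1 := d\<^sub>1, 2 := d\<^sub>2)).
       card (nonzero_slices n (d(1 := d\<^sub>1, 2 := d\<^sub>2)) 1 v) \<le> m\<^sub>1 \<and>
       card (nonzero_slices n (d(1 := d\<^sub>1, 2 := d\<^sub>2)) 2 v) \<le> m\<^sub>2)"
proof -
  let ?V1 = "complex_vertices \<Delta>\<^sub>1" and ?V2 = "complex_vertices \<Delta>\<^sub>2"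
  have \<Delta>: "\<Delta> = \<Delta>\<^sub>1 \<union> \<Delta>\<^sub>2" and S: "?V1 \<inter> ?V2 \<in> \<Delta>"
    using assms(2) by (auto simp: reducible_with_def)
  have V: "?V1 \<union> ?V2 = {1..n}"
    using assms(1) unfolding complex_on_def \<Delta> by (simp add: complex_vertices_def)
  then have "finite ?V1" "finite ?V2" by (metis finite_Un finite_atLeastAtMost)+
  moreover have "\<forall>F\<in>\<Delta>. F \<subseteq> ?V1 \<or> F \<subseteq> ?V2" unfolding \<Delta> complex_vertices_def by blast
  ultimately obtain K where K: "\<forall>d' x y. (\<forall>i\<in>?V1 - {1}. d' i = d i) \<longrightarrow> (\<forall>i\<in>?V2 - {2}. d' i = d i) \<longrightarrow>
     set_mset x \<subseteq> cells {1..n} d' \<longrightarrow> set_mset y \<subseteq> cells {1..n} d' \<longrightarrow> same_marginals \<Delta> x y \<longrightarrow>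
     size x > K \<longrightarrow> (overlap \<Delta> (cells {1..n} d'))\<^sup>*\<^sup>* x y"
    using overlap_connected[of ?V1 ?V2 \<Delta> 1 d 2] S unfolding V by blast
  \<comment> \<open>One constant serves both indices: a nonzero slice meets the positive or the
    negative part of \<open>v\<close>, and each part has at most \<open>K\<close> cells.\<close>
  have bound: "card (nonzero_slices n d' j v) \<le> 2 * K"
    if v: "v \<in> complex_universal_markov_basis n \<Delta> d'" and d': "d' = d(1 := d\<^sub>1, 2 := d\<^sub>2)" for d' d\<^sub>1 d\<^sub>2 v j
  proof -
    let ?C = "cells {1..n} d'" and ?R = "marginal_index \<Delta> d'" and ?A = "marginal_matrix n d'"
    have fin: "finite ?C" by (simp add: finite_cells)
    note fibre = same_fibre_marginal_matrix[OF assms(1), of d']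
    obtain M where M: "minimal_markov_basis ?R ?C ?A M" "v \<in> M"
      using v by (auto simp: complex_universal_markov_basis_def universal_markov_basis_def)
    \<comment> \<open>\<open>x\<close> is the negative part of \<open>v\<close>, and
      \<open>y\<close> below is its positive part.\<close>
    obtain x where x: "set_mset x \<subseteq> ?C" "\<And>c. c \<in> ?C \<Longrightarrow> count x c = nat (- v c)"
      using mset_from_counts[OF fin, where f = "\<lambda>c. nat (- v c)"] by blast
    obtain y where y: "set_mset y \<subseteq> ?C" "\<And>c. c \<in> ?C \<Longrightarrow> count y c = nat (v c)"
      using mset_from_counts[OF fin, where f = "\<lambda>c. nat (v c)"] by blast
    have "v \<in> int_kernel ?R ?C ?A"
      using M by (auto simp: minimal_markov_basis_def markov_basis_def)
    have "mat_apply ?C ?A (count x) r = mat_apply ?C ?A (count y) r" if "r \<in> ?R" for r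
    proof -
      have "mat_apply ?C ?A (\<lambda>c. int (count y c)) r = mat_apply ?C ?A (\<lambda>c. int (count x c)) r + mat_apply ?C ?A v r"
        unfolding mat_apply_def sum.distrib[symmetric]
        by (rule sum.cong) (simp_all add: x y flip: distrib_left)
      moreover have "mat_apply ?C ?A v r = 0"
        using \<open>v \<in> int_kernel ?R ?C ?A\<close> that by (simp add: int_kernel_def)
      ultimately show ?thesis by (simp flip: int_mat_apply)
    qed
    then have xy: "same_marginals \<Delta> x y"
      using fibre[of x y] x(1) y(1) by (simp add: same_fibre_def)
    have sizes: "size s = size t" if "same_fibre ?R ?C ?A s t" for s t
      using that same_marginals_size[of \<Delta> s t] S unfolding fibre by blast
    have "\<not> (overlap \<Delta> ?C)\<^sup>*\<^sup>* x y"
      using minimal_markov_basis_not_linked[OF fin M sizes x y]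
      unfolding fibre overlap_def conj_assoc by simp
    \<comment> \<open>\<open>d'\<close> differs from \<open>d\<close> at most at 1 and 2, while 2 is
      not in \<open>?V1\<close> and 1 is not in \<open>?V2\<close>. Hence the \<open>K\<close>
      obtained from \<open>d\<close> alone works for all \<open>d\<^sub>1\<close> and
      \<open>d\<^sub>2\<close>.\<close>
    moreover have "\<forall>i\<in>?V1 - {1}. d' i = d i" "\<forall>i\<in>?V2 - {2}. d' i = d i"
      using assms(3,4) unfolding d' by auto
    ultimately have "size x \<le> K"
      using K x(1) y(1) xy by (meson not_le)
    moreover have "size x = size y" using same_marginals_size[OF xy] S by blast
    moreover have "card (nonzero_slices n d' j v) \<le> size x + size y"
    proof -
      have "c \<in># x \<or> c \<in># y" if "c \<in> ?C" "v c \<noteq> 0" for c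
      proof -
        have "count x c \<noteq> 0 \<or> count y c \<noteq> 0" using x(2)[OF that(1)] y(2)[OF that(1)] that(2) by auto
        then show ?thesis by (simp add: count_eq_zero_iff)
      qed
      then have "nonzero_slices n d' j v \<subseteq> (\<lambda>c. c j) ` (set_mset x \<union> set_mset y)"
        by (auto simp: nonzero_slices_def)
      then have "card (nonzero_slices n d' j v) \<le> card (set_mset x \<union> set_mset y)"
        by (meson card_image_le card_mono finite_UnI finite_imageI finite_set_mset order_trans)
      also have "\<dots> \<le> size x + size y"
        using card_Un_le[of "set_mset x" "set_mset y"] card_set_mset_le_size[of x] card_set_mset_le_size[of y]
        by linarith
      finally show ?thesis .
    qed
    ultimately show ?thesis by simp
  qed
  show ?thesis
    by (intro exI[of _ "2 * K"] allI impI ballI conjI; rule bound) auto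
qed

end
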